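(* Let $1\le p_i\le+\infty$ and $\omega_i>0$ for $i=1,\dots,m$, let $x_1,\dots,x_n\in\mathbb{R}^d$ be demand points with weights $w_1,\dots,w_n>0$, $x_l\in P_{s_l}$, and $N=\{1,\dots,n\}$. The location problem (LocP) is equivalent to the following mixed-integer problem (LocP-F1): $$\min\sum_{l\in N}\sum_{i\in V}w_l\omega_i d_i^l$$ subject to 1. $\sum_{i\in V}u_i=1$; 2. $\sum_{e\in \mathrm{Ext}(P_i)}\mu_{ie}=u_i$ for all $i\in V$; 3. $\sum_{(s_l,j)\in A}z^l_{s_lj}-\sum_{(h,s_l)\in A}z^l_{hs_l}=1-u_{s_l}$ for all $l\in N$; 4. $\sum_{(i,j)\in A}z^l_{ij}-\sum_{(h,i)\in A}z^l_{hi}=-u_i$ for all $l\in N$, $i\in V\setminus\{s_l\}$; 5. $\sum_{(h,i)\in A}z^l_{hi}\le1-u_{s_l}$ for all $l\in N$, $i\in V$; 6. $\sum_{(i,j)\in A}z^l_{ij}\le1-u_{s_l}$ for all $l\in N$, $i\in V$; 7. $d^l_{s_l}\ge\big\|\sum_{e\in \mathrm{Ext}(P_{s_l})}\mu_{s_le}e+\sum_{(s_l,j)\in A}\sum_{e\in \mathrm{Ext}(F_{s_lj})}\lambda^l_{s_lje}e-x_l\big\|_{p_{s_l}}$ for all $l\in N$; 8. $d^l_i\ge\big\|\sum_{e\in \mathrm{Ext}(P_i)}\mu_{ie}e+\sum_{(i,j)\in A}\sum_{e\in \mathrm{Ext}(F_{ij})}\lambda^l_{ije}e-\sum_{(h,i)\in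 A}\sum_{e\in \mathrm{Ext}(F_{hi})}\lambda^l_{hie}e\big\|_{p_i}$ for all $l\in N$, $i\in V\setminus\{s_l\}$; 9. $\sum_{e\in \mathrm{Ext}(F_{ij})}\lambda^l_{ije}=z^l_{ij}$ for all $l\in N$, $(i,j)\in A$; 10. $d_i^l\ge0$ for all $l\in N,i\in V$; $z^l_{ij}\in\{0,1\}$ for all $l\in N,(i,j)\in A$; $\lambda^l_{ije}\ge0$ for all $l\in N,(i,j)\in A,e\in \mathrm{Ext}(F_{ij})$; $\mu_{ie}\ge0$ for all $i\in V,e\in \mathrm{Ext}(P_i)$; $u_i\in\{0,1\}$ for all $i\in V$. Here "equivalent" means: the two problems have the same optimal value; every optimal solution of (LocP) (a cell $P_t$, a location $x\in P_t$, and optimal paths and gate points from each $x_l$ to $x$) is encoded by an optimal solution of (LocP-F1) with $u_t=1$, $x=\sum_{e\in \mathrm{Ext}(P_t)}\mu_{te}e$, and $z^l,\lambda^l$ encoding the arcs and gate points of the path of demand point $l$; and conversely, for every optimal solution of (LocP-F1), the cell $P_t$ with $u_t=1$ and the point $x=\sum_{e\in \mathrm{Ext}(P_t)}\mu_{te}e$ are optimal for (LocP).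
   Context: Setting. $P_1,\dots,P_m\subseteq\mathbb{R}^d$ are the cells of a polyhedral subdivision, with $\mathrm{int}(P_i)\cap\mathrm{int}(P_j)=\emptyset$ for $i\ne j$; the cells are assumed to be polytopes (bounded polyhedra). Cell $P_i$ is endowed with the $\ell_{p_i}$-norm $\|\cdot\|_{p_i}$ and a weight $\omega_i>0$. The undirected graph $G=(V,E)$ has $V=\{1,\dots,m\}$ and $\{i,j\}\in E$ ($i\ne j$) iff $P_i$ and $P_j$ share a (nonempty) face; for $\{i,j\}\in E$, $F_{ij}=F_{ji}=P_i\cap P_j$ is their maximal common face. $\mathrm{Ext}(\cdot)$ denotes the set of extreme points of a polytope; $\mathrm{Ext}(F_{ij})=\mathrm{Ext}(P_i)\cap \mathrm{Ext}(P_j)$. $A=\{(i,j),(j,i):\{i,j\}\in E\}$. In sums such as $\sum_{(i,j)\in A}$ or $\sum_{(h,i)\in A}$ with $i$ fixed, the sum runs over all $j$ (resp. $h$) for which the pair is an arc. A demand point lying in several cells is assigned to exactly one of them in advance; $s_l$ is the index of the cell assigned to $x_l$. Problem (LocP): $$\inf_{t\in V,\ x\in P_t}\ \sum_{l\in N}w_l D_t(x_l,x),$$ where $D_t(x_l,x)=\omega_{s_l}\|x_l-x\|_{p_{s_l}}$ if $s_l=t$, and otherwise, with $i_0=s_l$ and $i_{k+1}=t$, $$D_t(x_l,x)=\inf\ \ \omega_{s_l}\|x_l-y_{s_li_1}\|_{p_{s_l}}+\sum_{r=1}^k\omega_{i_r}\|y_{i_{r-1}i_r}-y_{i_ri_{r+1}}\|_{p_{i_r}}+\omega_t\|y_{i_kt}-x\|_{p_t},$$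 the infimum being over all simple paths $(s_l,i_1,\dots,i_k,t)$ from $s_l$ to $t$ in $G$ (all vertices distinct, $k\ge0$) and all gate points $y_{i_ri_{r+1}}\in F_{i_ri_{r+1}}$, $r=0,\dots,k$ (value $+\infty$ if there is no such path, and likewise for infeasible minimization problems). *)

theory Defs
  imports "HOL-Analysis.Analysis"
begin

text \<open>The cells are \<open>P 1, \<dots>, P m\<close>, with norm exponents \<open>p i\<close> and weights \<open>\<omega> i\<close>. The demand points
  are \<open>a 1, \<dots>, a n\<close>, with weights \<open>w l\<close>; \<open>s l\<close> is the index of the cell to which \<open>a l\<close> is assigned.\<close>

definition lp_norm :: "ereal \<Rightarrow> real^'d \<Rightarrow> real" where
  "lp_norm p v = (if p = \<infinity> then infnorm v
     else (\<Sum>k\<in>UNIV. \<bar>v $ k\<bar> powr real_of_ereal p) powr (1 / real_of_ereal p))"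

definition Ext :: "'a::real_vector set \<Rightarrow> 'a set" where
  "Ext S = {e. e extreme_point_of S}"

text \<open>The intersection of two cells is a common face, which may be empty (\<open>{}\<close> is a face of every
  set). The cells need not cover the whole space, and their union need not be connected.\<close>

definition polytopal_subdivision :: "nat \<Rightarrow> (nat \<Rightarrow> (real^'d) set) \<Rightarrow> bool" where
  "polytopal_subdivision m P \<longleftrightarrow>
     (\<forall>i\<in>{1..m}. polytope (P i)) \<and>
     (\<forall>i\<in>{1..m}. \<forall>j\<in>{1..m}. i \<noteq> j \<longrightarrow>
        interior (P i) \<inter> interior (P j) = {} \<and>
        P i \<inter> P j face_of P i \<and> P i \<inter> P j face_of P j)"

definition edges :: "nat \<Rightarrow> (nat \<Rightarrow> (real^'d) set) \<Rightarrow> nat set set" where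
  "edges m P = {{i, j} | i j. i \<in> {1..m} \<and> j \<in> {1..m} \<and> i \<noteq> j \<and>
     (\<exists>F. F \<noteq> {} \<and> F face_of P i \<and> F face_of P j)}"

definition arcs :: "nat \<Rightarrow> (nat \<Rightarrow> (real^'d) set) \<Rightarrow> (nat \<times> nat) set" where
  "arcs m P = {(i, j). {i, j} \<in> edges m P}"

definition gate_face :: "(nat \<Rightarrow> (real^'d) set) \<Rightarrow> nat \<Rightarrow> nat \<Rightarrow> (real^'d) set" where
  "gate_face P i j = P i \<inter> P j"


definition simple_path :: "nat \<Rightarrow> (nat \<Rightarrow> (real^'d) set) \<Rightarrow> nat \<Rightarrow> nat \<Rightarrow> nat list \<Rightarrow> bool" where
  "simple_path m P i t vs \<longleftrightarrow>
     vs \<noteq> [] \<and> hd vs = i \<and> last vs = t \<and> distinct vs \<and> set vs \<subseteq> {1..m} \<and>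
     (\<forall>r. Suc r < length vs \<longrightarrow> {vs ! r, vs ! Suc r} \<in> edges m P)"

text \<open>A route is a simple path \<open>vs\<close> together with the list \<open>ys\<close> of gate points, where \<open>ys ! r\<close> lies on
  the common face of the cells \<open>vs ! r\<close> and \<open>vs ! Suc r\<close>. From a vertex to itself there is only the
  route \<open>([t], [])\<close>.\<close>

definition routes ::
    "nat \<Rightarrow> (nat \<Rightarrow> (real^'d) set) \<Rightarrow> nat \<Rightarrow> nat \<Rightarrow> (nat list \<times> (real^'d) list) set" where
  "routes m P i t = {(vs, ys). simple_path m P i t vs \<and> length vs = Suc (length ys) \<and>
     (\<forall>r<length ys. ys ! r \<in> gate_face P (vs ! r) (vs ! Suc r))}"

text \<open>Cell \<open>vs ! r\<close> is entered at \<open>(b # ys) ! r\<close> and left at \<open>(ys @ [x]) ! r\<close>.\<close>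

definition route_cost ::
    "(nat \<Rightarrow> ereal) \<Rightarrow> (nat \<Rightarrow> real) \<Rightarrow> real^'d \<Rightarrow> real^'d \<Rightarrow> nat list \<Rightarrow> (real^'d) list \<Rightarrow> real" where
  "route_cost p \<omega> b x vs ys =
     (\<Sum>r<length vs. \<omega> (vs ! r) * lp_norm (p (vs ! r)) ((b # ys) ! r - (ys @ [x]) ! r))"

definition path_dist ::
    "nat \<Rightarrow> (nat \<Rightarrow> (real^'d) set) \<Rightarrow> (nat \<Rightarrow> ereal) \<Rightarrow> (nat \<Rightarrow> real) \<Rightarrow>
     nat \<Rightarrow> nat \<Rightarrow> real^'d \<Rightarrow> real^'d \<Rightarrow> ereal" where
  "path_dist m P p \<omega> i t b x =
     (if i = t then ereal (\<omega> i * lp_norm (p i) (b - x))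
      else INF (vs, ys)\<in>routes m P i t. ereal (route_cost p \<omega> b x vs ys))"

definition locp_obj ::
    "nat \<Rightarrow> (nat \<Rightarrow> (real^'d) set) \<Rightarrow> (nat \<Rightarrow> ereal) \<Rightarrow> (nat \<Rightarrow> real) \<Rightarrow>
     nat \<Rightarrow> (nat \<Rightarrow> real^'d) \<Rightarrow> (nat \<Rightarrow> nat) \<Rightarrow> (nat \<Rightarrow> real) \<Rightarrow> nat \<Rightarrow> real^'d \<Rightarrow> ereal" where
  "locp_obj m P p \<omega> n a s w t x =
     (\<Sum>l\<in>{1..n}. ereal (w l) * path_dist m P p \<omega> (s l) t (a l) x)"

definition locp_value ::
    "nat \<Rightarrow> (nat \<Rightarrow> (real^'d) set) \<Rightarrow> (nat \<Rightarrow> ereal) \<Rightarrow> (nat \<Rightarrow> real) \<Rightarrow>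
     nat \<Rightarrow> (nat \<Rightarrow> real^'d) \<Rightarrow> (nat \<Rightarrow> nat) \<Rightarrow> (nat \<Rightarrow> real) \<Rightarrow> ereal" where
  "locp_value m P p \<omega> n a s w =
     (INF t\<in>{1..m}. INF x\<in>P t. locp_obj m P p \<omega> n a s w t x)"

text \<open>A location with infinite objective value is infeasible, hence never optimal.\<close>

definition locp_optimal ::
    "nat \<Rightarrow> (nat \<Rightarrow> (real^'d) set) \<Rightarrow> (nat \<Rightarrow> ereal) \<Rightarrow> (nat \<Rightarrow> real) \<Rightarrow>
     nat \<Rightarrow> (nat \<Rightarrow> real^'d) \<Rightarrow> (nat \<Rightarrow> nat) \<Rightarrow> (nat \<Rightarrow> real) \<Rightarrow> nat \<Rightarrow> real^'d \<Rightarrow> bool" where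
  "locp_optimal m P p \<omega> n a s w t x \<longleftrightarrow>
     t \<in> {1..m} \<and> x \<in> P t \<and>
     locp_obj m P p \<omega> n a s w t x = locp_value m P p \<omega> n a s w \<and>
     locp_obj m P p \<omega> n a s w t x < \<infinity>"

definition locp_optimal_routes ::
    "nat \<Rightarrow> (nat \<Rightarrow> (real^'d) set) \<Rightarrow> (nat \<Rightarrow> ereal) \<Rightarrow> (nat \<Rightarrow> real) \<Rightarrow>
     nat \<Rightarrow> (nat \<Rightarrow> real^'d) \<Rightarrow> (nat \<Rightarrow> nat) \<Rightarrow> nat \<Rightarrow> real^'d \<Rightarrow>
     (nat \<Rightarrow> nat list) \<Rightarrow> (nat \<Rightarrow> (real^'d) list) \<Rightarrow> bool" where
  "locp_optimal_routes m P p \<omega> n a s t x vs ys \<longleftrightarrow>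
     (\<forall>l\<in>{1..n}. (vs l, ys l) \<in> routes m P (s l) t \<and>
        ereal (route_cost p \<omega> (a l) x (vs l) (ys l)) = path_dist m P p \<omega> (s l) t (a l) x)"


text \<open>Only the values of the variables at the indices occurring in the constraints are relevant:
  \<open>uvar i\<close>, \<open>muvar i e\<close>, \<open>zvar l i j\<close>, \<open>lamvar l i j e\<close>, \<open>dvar l i\<close>.\<close>

record 'a f1_vars =
  uvar :: "nat \<Rightarrow> real"
  muvar :: "nat \<Rightarrow> 'a \<Rightarrow> real"
  zvar :: "nat \<Rightarrow> nat \<Rightarrow> nat \<Rightarrow> real"
  lamvar :: "nat \<Rightarrow> nat \<Rightarrow> nat \<Rightarrow> 'a \<Rightarrow> real"
  dvar :: "nat \<Rightarrow> nat \<Rightarrow> real"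

definition f1_location ::
    "(nat \<Rightarrow> (real^'d) set) \<Rightarrow> (real^'d) f1_vars \<Rightarrow> nat \<Rightarrow> real^'d" where
  "f1_location P S i = (\<Sum>e\<in>Ext (P i). muvar S i e *\<^sub>R e)"

definition f1_gate ::
    "(nat \<Rightarrow> (real^'d) set) \<Rightarrow> (real^'d) f1_vars \<Rightarrow> nat \<Rightarrow> nat \<Rightarrow> nat \<Rightarrow> real^'d" where
  "f1_gate P S l i j = (\<Sum>e\<in>Ext (gate_face P i j). lamvar S l i j e *\<^sub>R e)"

definition f1_obj ::
    "nat \<Rightarrow> (nat \<Rightarrow> real) \<Rightarrow> nat \<Rightarrow> (nat \<Rightarrow> real) \<Rightarrow> (real^'d) f1_vars \<Rightarrow> real" where
  "f1_obj m \<omega> n w S = (\<Sum>l\<in>{1..n}. \<Sum>i\<in>{1..m}. w l * \<omega> i * dvar S l i)"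

definition f1_feasible ::
    "nat \<Rightarrow> (nat \<Rightarrow> (real^'d) set) \<Rightarrow> (nat \<Rightarrow> ereal) \<Rightarrow>
     nat \<Rightarrow> (nat \<Rightarrow> real^'d) \<Rightarrow> (nat \<Rightarrow> nat) \<Rightarrow> (real^'d) f1_vars \<Rightarrow> bool" where
  "f1_feasible m P p n a s S \<longleftrightarrow>
     (\<Sum>i\<in>{1..m}. uvar S i) = 1 \<and>
     (\<forall>i\<in>{1..m}. (\<Sum>e\<in>Ext (P i). muvar S i e) = uvar S i) \<and>
     (\<forall>l\<in>{1..n}.
        (\<Sum>j | (s l, j) \<in> arcs m P. zvar S l (s l) j) -
        (\<Sum>h | (h, s l) \<in> arcs m P. zvar S l h (s l)) = 1 - uvar S (s l)) \<and>
     (\<forall>l\<in>{1..n}. \<forall>i\<in>{1..m} - {s l}.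
        (\<Sum>j | (i, j) \<in> arcs m P. zvar S l i j) -
        (\<Sum>h | (h, i) \<in> arcs m P. zvar S l h i) = - uvar S i) \<and>
     (\<forall>l\<in>{1..n}. \<forall>i\<in>{1..m}.
        (\<Sum>h | (h, i) \<in> arcs m P. zvar S l h i) \<le> 1 - uvar S (s l)) \<and>
     (\<forall>l\<in>{1..n}. \<forall>i\<in>{1..m}.
        (\<Sum>j | (i, j) \<in> arcs m P. zvar S l i j) \<le> 1 - uvar S (s l)) \<and>
     (\<forall>l\<in>{1..n}.
        dvar S l (s l) \<ge> lp_norm (p (s l))
          (f1_location P S (s l) + (\<Sum>j | (s l, j) \<in> arcs m P. f1_gate P S l (s l) j) - a l)) \<and>
     (\<forall>l\<in>{1..n}. \<forall>i\<in>{1..m} - {s l}.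
        dvar S l i \<ge> lp_norm (p i)
          (f1_location P S i + (\<Sum>j | (i, j) \<in> arcs m P. f1_gate P S l i j)
             - (\<Sum>h | (h, i) \<in> arcs m P. f1_gate P S l h i))) \<and>
     (\<forall>l\<in>{1..n}. \<forall>(i, j)\<in>arcs m P.
        (\<Sum>e\<in>Ext (gate_face P i j). lamvar S l i j e) = zvar S l i j) \<and>
     (\<forall>l\<in>{1..n}. \<forall>i\<in>{1..m}. dvar S l i \<ge> 0) \<and>
     (\<forall>l\<in>{1..n}. \<forall>(i, j)\<in>arcs m P. zvar S l i j \<in> {0, 1}) \<and>
     (\<forall>l\<in>{1..n}. \<forall>(i, j)\<in>arcs m P. \<forall>e\<in>Ext (gate_face P i j). lamvar S l i j e \<ge> 0) \<and>
     (\<forall>i\<in>{1..m}. \<forall>e\<in>Ext (P i). muvar S i e \<ge> 0) \<and>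
     (\<forall>i\<in>{1..m}. uvar S i \<in> {0, 1})"

definition f1_value ::
    "nat \<Rightarrow> (nat \<Rightarrow> (real^'d) set) \<Rightarrow> (nat \<Rightarrow> ereal) \<Rightarrow> (nat \<Rightarrow> real) \<Rightarrow>
     nat \<Rightarrow> (nat \<Rightarrow> real^'d) \<Rightarrow> (nat \<Rightarrow> nat) \<Rightarrow> (nat \<Rightarrow> real) \<Rightarrow> ereal" where
  "f1_value m P p \<omega> n a s w =
     (INF S\<in>{S. f1_feasible m P p n a s S}. ereal (f1_obj m \<omega> n w S))"

definition f1_optimal ::
    "nat \<Rightarrow> (nat \<Rightarrow> (real^'d) set) \<Rightarrow> (nat \<Rightarrow> ereal) \<Rightarrow> (nat \<Rightarrow> real) \<Rightarrow>
     nat \<Rightarrow> (nat \<Rightarrow> real^'d) \<Rightarrow> (nat \<Rightarrow> nat) \<Rightarrow> (nat \<Rightarrow> real) \<Rightarrow> (real^'d) f1_vars \<Rightarrow> bool" where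
  "f1_optimal m P p \<omega> n a s w S \<longleftrightarrow>
     f1_feasible m P p n a s S \<and> ereal (f1_obj m \<omega> n w S) = f1_value m P p \<omega> n a s w"

definition f1_encodes ::
    "nat \<Rightarrow> (nat \<Rightarrow> (real^'d) set) \<Rightarrow> nat \<Rightarrow> nat \<Rightarrow> real^'d \<Rightarrow>
     (nat \<Rightarrow> nat list) \<Rightarrow> (nat \<Rightarrow> (real^'d) list) \<Rightarrow> (real^'d) f1_vars \<Rightarrow> bool" where
  "f1_encodes m P n t x vs ys S \<longleftrightarrow>
     uvar S t = 1 \<and> x = f1_location P S t \<and>
     (\<forall>l\<in>{1..n}.
        (\<forall>(i, j)\<in>arcs m P. zvar S l i j =
           (if \<exists>r. Suc r < length (vs l) \<and> vs l ! r = i \<and> vs l ! Suc r = j then 1 else 0)) \<and>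
        (\<forall>r<length (ys l). ys l ! r = f1_gate P S l (vs l ! r) (vs l ! Suc r)))"

end

theory Submission
  imports Defs
begin

text \<open>A route together with convex coefficients for its gate points and for the location is a
  feasible point of (LocP-F1) whose cost is the cost of the route, every \<open>d\<close> being chosen equal to
  the norm that bounds it. Conversely, in a feasible point with \<open>u t = 1\<close> the arcs with \<open>z l i j = 1\<close>
  form a unit flow from \<open>s l\<close> to \<open>t\<close>, hence contain a simple path. By the degree bounds 5 and 6 no
  other selected arc touches that path in a way that constraints 7 and 8 see, so the norms along the path
  are those of the route. Cycles disjoint from the path only increase the objective. Since optimal
  routes are not known to exist in advance, the values are compared along almost optimal routes.\<close>

section \<open>Norms, arcs, and convex coefficients over extreme points\<close>

lemma lp_norm_nonneg: "0 \<le> lp_norm p v"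
  by (simp add: lp_norm_def infnorm_pos_le)

text \<open>Uses the convention \<open>0 powr y = 0\<close>. It makes cells that a route does not
  visit free of charge.\<close>

lemma lp_norm_zero [simp]: "lp_norm p 0 = 0"
  by (simp add: lp_norm_def infnorm_0)

lemma lp_norm_minus_commute: "lp_norm p (v - w) = lp_norm p (w - v)"
  by (simp add: lp_norm_def infnorm_sub abs_minus_commute)

lemma arcs_iff: "(i, j) \<in> arcs m P \<longleftrightarrow> {i, j} \<in> edges m P"
  by (simp add: arcs_def)

lemma arcsD:
  assumes "(i, j) \<in> arcs m P"
  shows "i \<in> {1..m}" "j \<in> {1..m}" "i \<noteq> j"
  using assms by (auto simp: arcs_def edges_def doubleton_eq_iff)

lemma finite_arcs_out [simp]: "finite {j. (i, j) \<in> arcs m P}"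
  by (rule finite_subset[of _ "{1..m}"]) (auto dest: arcsD)

lemma finite_arcs_in [simp]: "finite {h. (h, i) \<in> arcs m P}"
  by (rule finite_subset[of _ "{1..m}"]) (auto dest: arcsD)

lemma finite_Ext: "polytope S \<Longrightarrow> finite (Ext S)"
  for S :: "'a::euclidean_space set"
  unfolding Ext_def by (simp add: finite_polyhedron_extreme_points polytope_imp_polyhedron)

text \<open>By Minkowski's theorem a polytope is the convex hull of its finitely many extreme
  points. This translates between points and the variables \<mu> and \<lambda> of (LocP-F1). An
  empty polytope is covered, since the empty sum of coefficients is not 1.\<close>

lemma mem_polytope_iff_Ext:
  fixes S :: "'a::euclidean_space set"
  assumes "polytope S"
  shows "x \<in> S \<longleftrightarrow> (\<exists>c. (\<forall>e\<in>Ext S. 0 \<le> c e) \<and> (\<Sum>e\<in>Ext S. c e) = 1 \<and> (\<Sum>e\<in>Ext S. c e *\<^sub>R e) = x)"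
proof -
  have "S = convex hull (Ext S)"
    unfolding Ext_def
    using Krein_Milman_Minkowski[OF polytope_imp_compact[OF assms] polytope_imp_convex[OF assms]] .
  then show ?thesis
    using convex_hull_finite[OF finite_Ext[OF assms]] by auto
qed

section \<open>Finite sums, simple paths and unit flows\<close>

lemma sum_single_index:
  assumes "finite A" "k \<in> A" "\<And>j. j \<in> A \<Longrightarrow> j \<noteq> k \<Longrightarrow> f j = 0"
  shows "sum f A = f k"
  using assms by (simp add: sum.remove[of A k])

text \<open>Form in which the degree bounds are used: one selected arc at a vertex exhausts the
  bound, so every other arc there is unselected.\<close>

lemma sum_le_one_other_zero:
  fixes f :: "'a \<Rightarrow> real"
  assumes "finite A" "\<And>j. j \<in> A \<Longrightarrow> 0 \<le> f j" "sum f A \<le> 1" "k \<in> A" "f k = 1" "j \<in> A" "j \<noteq> k"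
  shows "f j = 0"
proof -
  have "f j \<le> sum f (A - {k})"
    using assms by (intro member_le_sum) auto
  then show ?thesis
    using assms by (simp add: sum.remove[of A k]) (use assms(2)[OF assms(6)] in linarith)
qed

text \<open>Induction along the chain. A new endpoint that is already on the list closes a cycle,
  which is removed by keeping only the prefix up to it; otherwise the endpoint is appended.\<close>

lemma simple_path_of_rtrancl:
  assumes "(i, t) \<in> R\<^sup>*"
  obtains vs where "vs \<noteq> []" "hd vs = i" "last vs = t" "distinct vs"
    "\<And>r. Suc r < length vs \<Longrightarrow> (vs ! r, vs ! Suc r) \<in> R"
proof -
  have "\<exists>vs. vs \<noteq> [] \<and> hd vs = i \<and> last vs = t \<and> distinct vs \<and>
      (\<forall>r. Suc r < length vs \<longrightarrow> (vs ! r, vs ! Suc r) \<in> R)"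
    using assms
  proof (induction rule: rtrancl_induct)
    case base
    show ?case by (rule exI[of _ "[i]"]) simp
  next
    case (step y z)
    then obtain vs where vs: "vs \<noteq> []" "hd vs = i" "last vs = y" "distinct vs"
      "\<forall>r. Suc r < length vs \<longrightarrow> (vs ! r, vs ! Suc r) \<in> R" by blast
    show ?case
    proof (cases "z \<in> set vs")
      case True
      then obtain q where q: "q < length vs" "vs ! q = z" by (auto simp: in_set_conv_nth)
      have "last (take (Suc q) vs) = z" "hd (take (Suc q) vs) = i"
        using q vs(1,2) by (auto simp: take_Suc_conv_app_nth[OF q(1)] hd_append hd_conv_nth)
      then show ?thesis
        using vs by (intro exI[of _ "take (Suc q) vs"]) auto
    next
      case False
      have "((vs @ [z]) ! r, (vs @ [z]) ! Suc r) \<in> R" if "Suc r < length (vs @ [z])" for r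
      proof (cases "Suc r < length vs")
        case True
        then show ?thesis using vs by (simp add: nth_append)
      next
        case False
        then have "r = length vs - 1" "Suc r = length vs" using that vs(1) by auto
        then show ?thesis using vs step by (simp add: nth_append last_conv_nth)
      qed
      then show ?thesis
        using vs False by (intro exI[of _ "vs @ [z]"]) auto
    qed
  qed
  with that show thesis by blast
qed

text \<open>Otherwise the net outflow of the set reachable from \<open>i\<close>, which no flow leaves, would be
  both \<open>1\<close> and nonpositive.\<close>
lemma unit_flow_reaches_sink:
  fixes z :: "'a \<Rightarrow> 'a \<Rightarrow> real"
  assumes "finite V" "i \<in> V"
    and nonneg: "\<And>j k. 0 \<le> z j k"
    and source: "(\<Sum>j\<in>V. z i j) - (\<Sum>h\<in>V. z h i) = 1"
    and balance: "\<And>k. k \<in> V \<Longrightarrow> k \<noteq> i \<Longrightarrow> k \<noteq> t \<Longrightarrow> (\<Sum>j\<in>V. z k j) - (\<Sum>h\<in>V. z h k) = 0"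
  shows "(i, t) \<in> {(j, k). j \<in> V \<and> k \<in> V \<and> z j k \<noteq> 0}\<^sup>*"
proof (rule ccontr)
  let ?R = "{(j, k). j \<in> V \<and> k \<in> V \<and> z j k \<noteq> 0}"
  define X where "X = {k \<in> V. (i, k) \<in> ?R\<^sup>*}"
  assume "(i, t) \<notin> ?R\<^sup>*"
  then have "t \<notin> X" by (simp add: X_def)
  have X: "finite X" "X \<subseteq> V" "i \<in> X" using assms(1,2) by (auto simp: X_def)
  have closed: "z j k = 0" if "j \<in> X" "k \<in> V - X" for j k
    using that by (auto simp: X_def dest: rtrancl_into_rtrancl)
  \<comment> \<open>Since \<open>t\<close> lies outside \<open>X\<close>, only \<open>i\<close> is
    unbalanced within \<open>X\<close>, and its net outflow is 1.\<close>
  have "(\<Sum>k\<in>X. (\<Sum>j\<in>V. z k j) - (\<Sum>h\<in>V. z h k)) = (\<Sum>k\<in>X. if k = i then 1 else 0)"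
    using X \<open>t \<notin> X\<close> source balance by (intro sum.cong) auto
  then have net: "(\<Sum>k\<in>X. (\<Sum>j\<in>V. z k j) - (\<Sum>h\<in>V. z h k)) = 1"
    using X by simp
  \<comment> \<open>Flow inside \<open>X\<close> counts once as outflow and once as inflow; flow
    entering \<open>X\<close> only adds to the inflow. Hence the net outflow of \<open>X\<close>
    cannot be positive.\<close>
  have "(\<Sum>k\<in>X. \<Sum>j\<in>V. z k j) = (\<Sum>k\<in>X. \<Sum>j\<in>X. z k j)"
    using X closed assms(1) by (intro sum.cong sum.mono_neutral_right) auto
  also have "\<dots> = (\<Sum>k\<in>X. \<Sum>h\<in>X. z h k)"
    by (rule sum.swap)
  also have "\<dots> \<le> (\<Sum>k\<in>X. \<Sum>h\<in>V. z h k)"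
    using X assms(1) nonneg by (intro sum_mono sum_mono2) auto
  finally show False using net by (simp add: sum_subtractf)
qed

section \<open>Routes, path distances and residuals\<close>

lemma simple_path_iff_arcs:
  "simple_path m P i t vs \<longleftrightarrow> vs \<noteq> [] \<and> hd vs = i \<and> last vs = t \<and> distinct vs \<and> set vs \<subseteq> {1..m} \<and>
     (\<forall>r. Suc r < length vs \<longrightarrow> (vs ! r, vs ! Suc r) \<in> arcs m P)"
  by (simp add: simple_path_def arcs_iff)

lemma routesD:
  assumes "(vs, ys) \<in> routes m P i t"
  shows "length vs = Suc (length ys)" "vs ! 0 = i" "vs ! length ys = t" "distinct vs"
    "set vs \<subseteq> {1..m}"
    "\<And>r. r < length ys \<Longrightarrow> (vs ! r, vs ! Suc r) \<in> arcs m P"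
    "\<And>r. r < length ys \<Longrightarrow> ys ! r \<in> gate_face P (vs ! r) (vs ! Suc r)"
  using assms by (auto simp: routes_def simple_path_iff_arcs hd_conv_nth last_conv_nth)

text \<open>Equal first and last entries of a distinct list have equal indices. So the separate case
  \<open>i = t\<close> of \<open>path_dist\<close> is the cost of the only route from
  \<open>t\<close> to itself, and both cases can be handled through routes.\<close>

lemma routes_selfD:
  assumes "(vs, ys) \<in> routes m P t t"
  shows "vs = [t]" "ys = []"
proof -
  note r = routesD[OF assms]
  have "0 = length ys"
    using r(1-3) nth_eq_iff_index_eq[OF r(4), of 0 "length ys"] by simp
  then show "ys = []" by simp
  with r(1,2) show "vs = [t]" by (cases vs) auto
qed

lemma routes_self: "t \<in> {1..m} \<Longrightarrow> ([t], []) \<in> routes m P t t"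
  by (simp add: routes_def simple_path_def)

lemma route_cost_self: "route_cost p \<omega> b x [t] [] = \<omega> t * lp_norm (p t) (b - x)"
  by (simp add: route_cost_def)

lemma route_cost_nonneg:
  assumes "(vs, ys) \<in> routes m P i t" "\<And>k. k \<in> {1..m} \<Longrightarrow> 0 < \<omega> k"
  shows "0 \<le> route_cost p \<omega> b x vs ys"
  unfolding route_cost_def
proof (rule sum_nonneg)
  fix r assume "r \<in> {..<length vs}"
  then have "0 < \<omega> (vs ! r)"
    using routesD(5)[OF assms(1)] assms(2) nth_mem by blast
  then show "0 \<le> \<omega> (vs ! r) * lp_norm (p (vs ! r)) ((b # ys) ! r - (ys @ [x]) ! r)"
    by (simp add: lp_norm_nonneg)
qed

lemma path_dist_le_route_cost:
  assumes "(vs, ys) \<in> routes m P i t"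
  shows "path_dist m P p \<omega> i t b x \<le> ereal (route_cost p \<omega> b x vs ys)"
proof (cases "i = t")
  case True
  then show ?thesis
    using routes_selfD[of vs ys m P t] assms by (simp add: path_dist_def route_cost_self)
next
  case False
  then show ?thesis
    using assms by (auto simp: path_dist_def intro!: INF_lower2[where i = "(vs, ys)"])
qed

lemma path_dist_nonneg:
  assumes "i \<in> {1..m}" "\<And>k. k \<in> {1..m} \<Longrightarrow> 0 < \<omega> k"
  shows "0 \<le> path_dist m P p \<omega> i t b x"
  using assms less_imp_le[OF assms(2)[OF assms(1)]]
  by (auto simp: path_dist_def lp_norm_nonneg intro!: INF_greatest route_cost_nonneg)

lemma path_dist_approx:
  assumes "i \<in> {1..m}" "path_dist m P p \<omega> i t b x < \<infinity>" "0 < \<epsilon>"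
    and pos: "\<And>k. k \<in> {1..m} \<Longrightarrow> 0 < \<omega> k"
  obtains vs ys where "(vs, ys) \<in> routes m P i t"
    "ereal (route_cost p \<omega> b x vs ys) \<le> path_dist m P p \<omega> i t b x + ereal \<epsilon>"
proof (cases "i = t")
  case True
  show thesis
    by (rule that[of "[i]" "[]"])
      (use True assms routes_self in \<open>auto simp: path_dist_def route_cost_self\<close>)
next
  case False
  let ?D = "path_dist m P p \<omega> i t b x"
  have "?D \<noteq> \<infinity>" "?D \<noteq> - \<infinity>"
    using assms(2) path_dist_nonneg[where P = P and p = p and t = t and b = b and x = x, OF assms(1) pos] by auto
  \<comment> \<open>Strictness requires a finite \<open>?D\<close>: nonnegativity excludes
    -\<infinity> and the assumption excludes \<infinity>.\<close>
  then have "?D < ?D + ereal \<epsilon>"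
    using assms(3) by (cases ?D) auto
  then obtain vs ys where "(vs, ys) \<in> routes m P i t"
      "ereal (route_cost p \<omega> b x vs ys) < ?D + ereal \<epsilon>"
    using False by (auto simp: path_dist_def INF_less_iff)
  then show thesis using that by (meson less_imp_le)
qed

text \<open>The argument of the norm in constraints 7 and 8 of (LocP-F1).\<close>
definition f1_residual ::
    "nat \<Rightarrow> (nat \<Rightarrow> (real^'d) set) \<Rightarrow> (nat \<Rightarrow> real^'d) \<Rightarrow> (nat \<Rightarrow> nat) \<Rightarrow>
     (real^'d) f1_vars \<Rightarrow> nat \<Rightarrow> nat \<Rightarrow> real^'d" where
  "f1_residual m P a s S l i =
     f1_location P S i + (\<Sum>j | (i, j) \<in> arcs m P. f1_gate P S l i j) -
       (if i = s l then a l else (\<Sum>h | (h, i) \<in> arcs m P. f1_gate P S l h i))"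

lemma f1_residual_dvar_update [simp]:
  "f1_residual m P a s (S\<lparr>dvar := d\<rparr>) = f1_residual m P a s S"
  by (simp add: f1_residual_def f1_location_def f1_gate_def fun_eq_iff)

text \<open>Once each gate sum along the route has collapsed to a single gate point, the residual of
  a visited cell is its exit point minus its entry point. Used in both directions of the
  equivalence.\<close>

lemma route_cost_eq_residuals:
  assumes route: "(vs, ys) \<in> routes m P (s l) t"
    and loc: "\<And>i. i \<in> {1..m} \<Longrightarrow> f1_location P S i = (if i = t then x else 0)"
    and outs: "\<And>r. r < length ys \<Longrightarrow> (\<Sum>j | (vs ! r, j) \<in> arcs m P. f1_gate P S l (vs ! r) j) = ys ! r"
    and out_t: "(\<Sum>j | (t, j) \<in> arcs m P. f1_gate P S l t j) = 0"
    and ins: "\<And>r. r < length ys \<Longrightarrow> (\<Sum>h | (h, vs ! Suc r) \<in> arcs m P. f1_gate P S l h (vs ! Suc r)) = ys ! r"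
  shows "route_cost p \<omega> (a l) x vs ys = (\<Sum>i\<in>set vs. \<omega> i * lp_norm (p i) (f1_residual m P a s S l i))"
proof -
  note R = routesD[OF route]
  have resid: "f1_residual m P a s S l (vs ! r) = (ys @ [x]) ! r - (a l # ys) ! r"
    if "r < length vs" for r
  proof -
    have "r \<le> length ys" "vs ! r \<in> {1..m}" using that R(1,5) nth_mem by (force, blast)
    \<comment> \<open>Distinctness turns the tests for the end cells into tests on the index
      \<open>r\<close>.\<close>
    have t: "vs ! r = t \<longleftrightarrow> r = length ys"
      using nth_eq_iff_index_eq[OF R(4) that, of "length ys"] R(1,3) by simp
    have s: "vs ! r = s l \<longleftrightarrow> r = 0"
      using nth_eq_iff_index_eq[OF R(4) that, of 0] R(1,2) by simp
    \<comment> \<open>Exit point: in the last cell the gate sum vanishes and the location is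
      \<open>x\<close>; in all earlier cells the location term is 0 and the gate sum is
      \<open>ys ! r\<close>.\<close>
    have "f1_location P S (vs ! r) + (\<Sum>j | (vs ! r, j) \<in> arcs m P. f1_gate P S l (vs ! r) j)
        = (ys @ [x]) ! r"
      using loc[OF \<open>vs ! r \<in> {1..m}\<close>] t out_t outs[of r] \<open>r \<le> length ys\<close>
      by (cases "r = length ys") (auto simp: nth_append R(3))
    \<comment> \<open>Entry point: for \<open>r = 0\<close> the demand point replaces the inflow,
      and for \<open>r = Suc q\<close> the inflow is \<open>ys ! q\<close>; hence the shift by one
      in \<open>a l # ys\<close>.\<close>
    moreover have "(if vs ! r = s l then a l else (\<Sum>h | (h, vs ! r) \<in> arcs m P. f1_gate P S l h (vs ! r)))
        = (a l # ys) ! r"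
      using s ins[of "r - 1"] that R(1,2) by (cases r) auto
    ultimately show ?thesis by (simp only: f1_residual_def)
  qed
  \<comment> \<open>\<open>route_cost\<close> takes entry minus exit, so the sign is absorbed by the
    symmetry of the norm. Distinctness then allows summing over visited cells instead of
    indices.\<close>
  have "route_cost p \<omega> (a l) x vs ys =
      (\<Sum>r<length vs. \<omega> (vs ! r) * lp_norm (p (vs ! r)) (f1_residual m P a s S l (vs ! r)))"
    unfolding route_cost_def
    by (intro sum.cong refl) (simp add: resid lp_norm_minus_commute)
  also have "\<dots> = (\<Sum>i\<in>set vs. \<omega> i * lp_norm (p i) (f1_residual m P a s S l i))"
    using sum.reindex_bij_betw[OF bij_betw_nth[OF R(4) refl refl]] by simp
  finally show ?thesis .
qed

section \<open>Consequences of feasibility\<close>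

lemma polytope_cells:
  assumes "polytopal_subdivision m P" "i \<in> {1..m}"
  shows "polytope (P i)"
  using assms by (simp add: polytopal_subdivision_def)

lemma polytope_gate_face:
  assumes "polytopal_subdivision m P" "i \<in> {1..m}" "j \<in> {1..m}"
  shows "polytope (gate_face P i j)"
  unfolding gate_face_def using assms by (intro polytope_Int) (auto simp: polytopal_subdivision_def)

lemma sum_unit_choice:
  fixes f :: "'a \<Rightarrow> real"
  assumes "finite A" "\<And>i. i \<in> A \<Longrightarrow> f i \<in> {0, 1}" "sum f A = 1"
  shows "\<exists>!i. i \<in> A \<and> f i = 1"
proof -
  obtain k where k: "k \<in> A" "f k = 1"
    using assms sum.neutral[of A f] by (metis insertE singletonD zero_neq_one)
  moreover have "f j = 0" if "j \<in> A" "j \<noteq> k" for j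
    by (rule sum_le_one_other_zero[of A f k]) (use assms k that in force)+
  ultimately show ?thesis by (metis zero_neq_one)
qed

text \<open>Constraints 7 and 8 merge into one bound, because \<open>f1_residual\<close>
  distinguishes \<open>i = s l\<close> itself.\<close>

lemma f1_feasibleD:
  assumes "f1_feasible m P p n a s S"
  shows "(\<Sum>i\<in>{1..m}. uvar S i) = 1"
    and "i \<in> {1..m} \<Longrightarrow> uvar S i \<in> {0, 1}"
    and "i \<in> {1..m} \<Longrightarrow> (\<Sum>e\<in>Ext (P i). muvar S i e) = uvar S i"
    and "i \<in> {1..m} \<Longrightarrow> e \<in> Ext (P i) \<Longrightarrow> 0 \<le> muvar S i e"
    and "l \<in> {1..n} \<Longrightarrow>
      (\<Sum>j | (s l, j) \<in> arcs m P. zvar S l (s l) j) - (\<Sum>h | (h, s l) \<in> arcs m P. zvar S l h (s l))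
      = 1 - uvar S (s l)"
    and "l \<in> {1..n} \<Longrightarrow> i \<in> {1..m} \<Longrightarrow> i \<noteq> s l \<Longrightarrow>
      (\<Sum>j | (i, j) \<in> arcs m P. zvar S l i j) - (\<Sum>h | (h, i) \<in> arcs m P. zvar S l h i) = - uvar S i"
    and "l \<in> {1..n} \<Longrightarrow> i \<in> {1..m} \<Longrightarrow> (\<Sum>h | (h, i) \<in> arcs m P. zvar S l h i) \<le> 1 - uvar S (s l)"
    and "l \<in> {1..n} \<Longrightarrow> i \<in> {1..m} \<Longrightarrow> (\<Sum>j | (i, j) \<in> arcs m P. zvar S l i j) \<le> 1 - uvar S (s l)"
    and "l \<in> {1..n} \<Longrightarrow> i \<in> {1..m} \<Longrightarrow> lp_norm (p i) (f1_residual m P a s S l i) \<le> dvar S l i"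
    and "l \<in> {1..n} \<Longrightarrow> (i, j) \<in> arcs m P \<Longrightarrow> zvar S l i j \<in> {0, 1}"
    and "l \<in> {1..n} \<Longrightarrow> (i, j) \<in> arcs m P \<Longrightarrow>
      (\<Sum>e\<in>Ext (gate_face P i j). lamvar S l i j e) = zvar S l i j"
    and "l \<in> {1..n} \<Longrightarrow> (i, j) \<in> arcs m P \<Longrightarrow> e \<in> Ext (gate_face P i j) \<Longrightarrow> 0 \<le> lamvar S l i j e"
  using assms unfolding f1_feasible_def Ball_def split_paired_All case_prod_conv
  by (elim conjE, simp_all add: f1_residual_def del: One_nat_def)

lemma f1_feasible_unique_cell:
  assumes "f1_feasible m P p n a s S"
  shows "\<exists>!t. t \<in> {1..m} \<and> uvar S t = 1"
  by (rule sum_unit_choice) (use f1_feasibleD(1,2)[OF assms] in auto)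

text \<open>Nonnegative coefficients with sum 1 form a convex combination; with sum 0 they all
  vanish, so an unchosen cell contributes the zero vector to the residuals. The same argument
  applies to gates below.\<close>

lemma f1_feasible_location:
  assumes sub: "polytopal_subdivision m P" and feas: "f1_feasible m P p n a s S"
    and "i \<in> {1..m}"
  shows "uvar S i = 1 \<Longrightarrow> f1_location P S i \<in> P i" "uvar S i = 0 \<Longrightarrow> f1_location P S i = 0"
proof -
  have mu: "(\<Sum>e\<in>Ext (P i). muvar S i e) = uvar S i" "\<forall>e\<in>Ext (P i). 0 \<le> muvar S i e"
    using f1_feasibleD(3,4)[OF feas \<open>i \<in> {1..m}\<close>] by blast+
  note poly = polytope_cells[OF sub \<open>i \<in> {1..m}\<close>]
  show "f1_location P S i \<in> P i" if "uvar S i = 1"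
    unfolding mem_polytope_iff_Ext[OF poly] f1_location_def using mu that by auto
  show "f1_location P S i = 0" if "uvar S i = 0"
    using mu that sum_nonneg_eq_0_iff[OF finite_Ext[OF poly], of "muvar S i"]
    by (simp add: f1_location_def)
qed

lemma f1_feasible_gate:
  assumes sub: "polytopal_subdivision m P" and feas: "f1_feasible m P p n a s S"
    and "l \<in> {1..n}" and arc: "(i, j) \<in> arcs m P"
  shows "zvar S l i j = 1 \<Longrightarrow> f1_gate P S l i j \<in> gate_face P i j"
    "zvar S l i j = 0 \<Longrightarrow> f1_gate P S l i j = 0"
proof -
  have lam: "(\<Sum>e\<in>Ext (gate_face P i j). lamvar S l i j e) = zvar S l i j"
    "\<forall>e\<in>Ext (gate_face P i j). 0 \<le> lamvar S l i j e"
    using f1_feasibleD(11,12)[OF feas \<open>l \<in> {1..n}\<close> arc] by blast+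
  note poly = polytope_gate_face[OF sub arcsD(1,2)[OF arc]]
  show "f1_gate P S l i j \<in> gate_face P i j" if "zvar S l i j = 1"
    unfolding mem_polytope_iff_Ext[OF poly] f1_gate_def using lam that by auto
  show "f1_gate P S l i j = 0" if "zvar S l i j = 0"
    using lam that sum_nonneg_eq_0_iff[OF finite_Ext[OF poly], of "lamvar S l i j"]
    by (simp add: f1_gate_def)
qed

section \<open>From a feasible point to routes\<close>

text \<open>Shows that a feasible point pays, for each demand point, at least the path distance to
  the location it encodes.\<close>

lemma route_from_f1_feasible:
  assumes sub: "polytopal_subdivision m P"
    and pos: "\<And>i. i \<in> {1..m} \<Longrightarrow> 0 < \<omega> i"
    and s: "s l \<in> {1..m}" and l: "l \<in> {1..n}"
    and feas: "f1_feasible m P p n a s S"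
    and t: "t \<in> {1..m}" "uvar S t = 1"
  obtains vs ys where "(vs, ys) \<in> routes m P (s l) t"
    "route_cost p \<omega> (a l) (f1_location P S t) vs ys \<le> (\<Sum>i\<in>{1..m}. \<omega> i * dvar S l i)"
proof -
  let ?z = "zvar S l"
  define out where "out i = (\<Sum>j | (i, j) \<in> arcs m P. ?z i j)" for i
  define inn where "inn i = (\<Sum>h | (h, i) \<in> arcs m P. ?z h i)" for i
  have z01: "?z i j \<in> {0, 1}" if "(i, j) \<in> arcs m P" for i j
    by (rule f1_feasibleD(10)[OF feas l that])
  have u: "uvar S i = (if i = t then 1 else 0)" if "i \<in> {1..m}" for i
    using f1_feasible_unique_cell[OF feas] t f1_feasibleD(2)[OF feas that] that by auto
  have src: "out (s l) - inn (s l) = 1 - uvar S (s l)"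
    and bal: "\<And>i. i \<in> {1..m} \<Longrightarrow> i \<noteq> s l \<Longrightarrow> out i - inn i = - uvar S i"
    and le: "\<And>i. i \<in> {1..m} \<Longrightarrow> inn i \<le> 1 - uvar S (s l)"
            "\<And>i. i \<in> {1..m} \<Longrightarrow> out i \<le> 1 - uvar S (s l)"
    unfolding out_def inn_def using f1_feasibleD(5-8)[OF feas l] by blast+
  have z0: "0 \<le> ?z i j" if "(i, j) \<in> arcs m P" for i j
    using z01[OF that] by auto
  then have "0 \<le> out i" "0 \<le> inn i" for i
    by (auto simp: out_def inn_def intro!: sum_nonneg)
  have le1: "out i \<le> 1" "inn i \<le> 1" if "i \<in> {1..m}" for i
    using le[OF that] u[OF s] by (auto split: if_splits)
  \<comment> \<open>If \<open>s l = t\<close>, the bound \<open>1 - uvar S (s l)\<close> is 0.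
    Otherwise the balance at \<open>t\<close> gives \<open>out t = inn t - 1\<close>, and
    \<open>inn t\<close> is at most 1.\<close>
  have out_t: "out t \<le> 0"
    using le le1 bal src t u[OF s] by (cases "s l = t") force+
  define R where "R = {(i, j). (i, j) \<in> arcs m P \<and> ?z i j = 1}"
  have "(s l, t) \<in> R\<^sup>*"
  proof (cases "s l = t")
    case False
    \<comment> \<open>Extension by 0 to all pairs of cells, so that the flow lemma applies with sums
      over \<open>{1..m}\<close>.\<close>
    define z where "z i j = (if (i, j) \<in> arcs m P then ?z i j else 0)" for i j
    have outz: "(\<Sum>j\<in>{1..m}. z i j) = out i" for i
      unfolding out_def z_def
      by (rule sum.mono_neutral_cong_right) (auto dest: arcsD)
    have innz: "(\<Sum>h\<in>{1..m}. z h i) = inn i" for i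
      unfolding inn_def z_def
      by (rule sum.mono_neutral_cong_right) (auto dest: arcsD)
    have "(s l, t) \<in> {(j, k). j \<in> {1..m} \<and> k \<in> {1..m} \<and> z j k \<noteq> 0}\<^sup>*"
    proof (rule unit_flow_reaches_sink)
      show "0 \<le> z j k" for j k using z01[of j k] by (auto simp: z_def)
      show "(\<Sum>j\<in>{1..m}. z (s l) j) - (\<Sum>h\<in>{1..m}. z h (s l)) = 1"
        using src u[OF s] False by (simp only: outz innz) simp
      show "(\<Sum>j\<in>{1..m}. z k j) - (\<Sum>h\<in>{1..m}. z h k) = 0"
        if "k \<in> {1..m}" "k \<noteq> s l" "k \<noteq> t" for k
        using bal[of k] u[of k] that by (simp only: outz innz) simp
    qed (use s in auto)
    moreover have "{(j, k). j \<in> {1..m} \<and> k \<in> {1..m} \<and> z j k \<noteq> 0} \<subseteq> R"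
      using z01 by (auto simp: R_def z_def split: if_splits)
    ultimately show ?thesis using rtrancl_mono by blast
  qed simp
  then obtain vs where vs: "vs \<noteq> []" "hd vs = s l" "last vs = t" "distinct vs"
    and vsR: "\<And>r. Suc r < length vs \<Longrightarrow> (vs ! r, vs ! Suc r) \<in> R"
    using simple_path_of_rtrancl[of "s l" t R] by metis
  have vs_arc: "(vs ! r, vs ! Suc r) \<in> arcs m P" "?z (vs ! r) (vs ! Suc r) = 1" if "Suc r < length vs" for r
    using vsR[OF that] by (auto simp: R_def)
  have "vs ! r \<in> {1..m}" if "r < length vs" for r
  proof (cases r)
    case 0
    then show ?thesis using vs s by (simp add: hd_conv_nth)
  next
    case (Suc q)
    then show ?thesis using vs_arc(1)[of q] that arcsD(2) by blast
  qed
  then have set_vs: "set vs \<subseteq> {1..m}" by (auto simp: in_set_conv_nth)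
  \<comment> \<open>One gate per consecutive pair of cells, hence one fewer than the cells.\<close>
  define ys where "ys = map (\<lambda>r. f1_gate P S l (vs ! r) (vs ! Suc r)) [0..<length vs - 1]"
  have len: "length vs = Suc (length ys)" using vs(1) by (simp add: ys_def)
  have ys: "ys ! r = f1_gate P S l (vs ! r) (vs ! Suc r)" if "r < length ys" for r
    using that by (simp add: ys_def)
  note gate = f1_feasible_gate[OF sub feas l]
  have route: "(vs, ys) \<in> routes m P (s l) t"
    using vs set_vs vs_arc len ys gate(1)
    by (auto simp: routes_def simple_path_iff_arcs)
  have outs: "(\<Sum>j | (vs ! r, j) \<in> arcs m P. f1_gate P S l (vs ! r) j) = ys ! r" if "r < length ys" for r
  proof -
    have q: "Suc r < length vs" using that len by simp
    note arc = vs_arc[OF q]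
    \<comment> \<open>The path arc already uses up the out-degree bound 1 of this cell.\<close>
    have "?z (vs ! r) j = 0" if "(vs ! r, j) \<in> arcs m P" "j \<noteq> vs ! Suc r" for j
      by (rule sum_le_one_other_zero[of "{j. (vs ! r, j) \<in> arcs m P}" "?z (vs ! r)" "vs ! Suc r"])
        (use that arc z01 le1(1)[OF arcsD(1)[OF arc(1)]] in \<open>force simp: out_def\<close>)+
    then show ?thesis
      unfolding ys[OF that] using arc gate(2) by (intro sum_single_index) auto
  qed
  have ins: "(\<Sum>h | (h, vs ! Suc r) \<in> arcs m P. f1_gate P S l h (vs ! Suc r)) = ys ! r" if "r < length ys" for r
  proof -
    have q: "Suc r < length vs" using that len by simp
    note arc = vs_arc[OF q]
    have "?z h (vs ! Suc r) = 0" if "(h, vs ! Suc r) \<in> arcs m P" "h \<noteq> vs ! r" for h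
      by (rule sum_le_one_other_zero[of "{h. (h, vs ! Suc r) \<in> arcs m P}" "\<lambda>h. ?z h (vs ! Suc r)" "vs ! r"])
        (use that arc z01 le1(2)[OF arcsD(2)[OF arc(1)]] in \<open>force simp: inn_def\<close>)+
    then show ?thesis
      unfolding ys[OF that] using arc gate(2)
      by (intro sum_single_index[where f = "\<lambda>h. f1_gate P S l h (vs ! Suc r)"]) auto
  qed
  have "?z t j = 0" if "(t, j) \<in> arcs m P" for j
  proof -
    have "?z t j \<le> out t"
      unfolding out_def by (rule member_le_sum) (use that z0 in auto)
    then show ?thesis using out_t z0[OF that] by simp
  qed
  then have gates_t: "(\<Sum>j | (t, j) \<in> arcs m P. f1_gate P S l t j) = 0"
    using gate(2) by (intro sum.neutral) auto
  have loc: "f1_location P S i = (if i = t then f1_location P S t else 0)" if "i \<in> {1..m}" for i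
    using f1_feasible_location(2)[OF sub feas that] u[OF that] by simp
  have d: "lp_norm (p i) (f1_residual m P a s S l i) \<le> dvar S l i" if "i \<in> {1..m}" for i
    by (rule f1_feasibleD(9)[OF feas l that])
  have "route_cost p \<omega> (a l) (f1_location P S t) vs ys =
      (\<Sum>i\<in>set vs. \<omega> i * lp_norm (p i) (f1_residual m P a s S l i))"
    by (rule route_cost_eq_residuals[where s = s and l = l and a = a, OF route loc outs gates_t ins])
  also have "\<dots> \<le> (\<Sum>i\<in>set vs. \<omega> i * dvar S l i)"
  proof (intro sum_mono mult_left_mono)
    fix i assume "i \<in> set vs"
    then have "i \<in> {1..m}" using set_vs by blast
    then show "lp_norm (p i) (f1_residual m P a s S l i) \<le> dvar S l i" "0 \<le> \<omega> i"
      using d pos less_imp_le by blast+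
  qed
  \<comment> \<open>Cells off the path, such as those on disjoint cycles, only add nonnegative
    terms.\<close>
  also have "\<dots> \<le> (\<Sum>i\<in>{1..m}. \<omega> i * dvar S l i)"
  proof (intro sum_mono2 mult_nonneg_nonneg)
    fix i assume "i \<in> {1..m} - set vs"
    then have i: "i \<in> {1..m}" by simp
    show "0 \<le> \<omega> i" using pos[OF i] by simp
    show "0 \<le> dvar S l i" using lp_norm_nonneg d[OF i] by (rule order_trans)
  qed (use set_vs in auto)
  finally show thesis using that route by blast
qed

section \<open>From routes to a feasible point\<close>

text \<open>On a distinct list each cell has at most one outgoing and one incoming path arc, none
  leaving the last and none entering the first cell. The value type is general because
  \<open>F\<close> is instantiated both by the numbers \<open>z\<close> and by the gate
  vectors.\<close>

lemma path_sums:
  fixes F :: "nat \<Rightarrow> nat \<Rightarrow> 'b::comm_monoid_add"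
  assumes route: "(vs, ys) \<in> routes m P i t"
    and off: "\<And>j k. (j, k) \<in> arcs m P \<Longrightarrow>
      \<not> (\<exists>r. Suc r < length vs \<and> vs ! r = j \<and> vs ! Suc r = k) \<Longrightarrow> F j k = 0"
  shows "r < length ys \<Longrightarrow> (\<Sum>k | (vs ! r, k) \<in> arcs m P. F (vs ! r) k) = F (vs ! r) (vs ! Suc r)"
    and "r < length ys \<Longrightarrow> (\<Sum>j | (j, vs ! Suc r) \<in> arcs m P. F j (vs ! Suc r)) = F (vs ! r) (vs ! Suc r)"
    and "k \<notin> set vs \<or> k = t \<Longrightarrow> (\<Sum>j | (k, j) \<in> arcs m P. F k j) = 0"
    and "k \<notin> set vs \<or> k = i \<Longrightarrow> (\<Sum>j | (j, k) \<in> arcs m P. F j k) = 0"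
proof -
  note R = routesD[OF route]
  have inj: "vs ! q = vs ! r \<longleftrightarrow> q = r" if "q < length vs" "r < length vs" for q r
    using nth_eq_iff_index_eq[OF R(4)] that by simp
  show "(\<Sum>k | (vs ! r, k) \<in> arcs m P. F (vs ! r) k) = F (vs ! r) (vs ! Suc r)" if "r < length ys"
    using that R(1,6) inj by (intro sum_single_index off) auto
  show "(\<Sum>j | (j, vs ! Suc r) \<in> arcs m P. F j (vs ! Suc r)) = F (vs ! r) (vs ! Suc r)" if "r < length ys"
    using that R(1,6) inj
    by (intro sum_single_index[where f = "\<lambda>j. F j (vs ! Suc r)"] off) auto
  show "(\<Sum>j | (k, j) \<in> arcs m P. F k j) = 0" if "k \<notin> set vs \<or> k = t"
    using that R(1) inj[of _ "length ys"] unfolding R(3)[symmetric]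
    by (intro sum.neutral ballI off) auto
  show "(\<Sum>j | (j, k) \<in> arcs m P. F j k) = 0" if "k \<notin> set vs \<or> k = i"
    using that R(1) inj[of _ 0] unfolding R(2)[symmetric]
    by (intro sum.neutral ballI off) auto
qed

text \<open>On a path arc the coefficients represent its gate point, elsewhere they are 0. Arbitrary
  pairs \<open>j\<close>, \<open>k\<close> are allowed so that all coefficients can be chosen at
  once.\<close>

lemma gate_coefficients:
  assumes sub: "polytopal_subdivision m P" and route: "(vs, ys) \<in> routes m P i t"
  defines "on \<equiv> \<lambda>j k. \<exists>r. Suc r < length vs \<and> vs ! r = j \<and> vs ! Suc r = k"
  shows "\<exists>c. (\<forall>e\<in>Ext (gate_face P j k). 0 \<le> c e) \<and>
    (\<Sum>e\<in>Ext (gate_face P j k). c e) = (if on j k then 1 else 0::real) \<and>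
    (\<not> on j k \<longrightarrow> (\<Sum>e\<in>Ext (gate_face P j k). c e *\<^sub>R e) = 0) \<and>
    (\<forall>r<length ys. vs ! r = j \<longrightarrow> vs ! Suc r = k \<longrightarrow>
       (\<Sum>e\<in>Ext (gate_face P j k). c e *\<^sub>R e) = ys ! r)"
proof (cases "on j k")
  case True
  note R = routesD[OF route]
  from True obtain r where r: "r < length ys" "vs ! r = j" "vs ! Suc r = k"
    by (auto simp: on_def R(1))
  \<comment> \<open>A pair of cells occurs at one index only, so a single choice of coefficients
    serves every index in the claim.\<close>
  have uniq: "q = r" if "q < length ys" "vs ! q = j" for q
    using nth_eq_iff_index_eq[OF R(4), of q r] that r R(1) by simp
  have "polytope (gate_face P j k)"
    using polytope_gate_face[OF sub] arcsD(1,2)[OF R(6)[OF r(1)]] r by simp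
  moreover have "ys ! r \<in> gate_face P j k"
    using R(7)[OF r(1)] r by simp
  ultimately obtain c where "\<forall>e\<in>Ext (gate_face P j k). 0 \<le> c e"
    "(\<Sum>e\<in>Ext (gate_face P j k). c e) = 1" "(\<Sum>e\<in>Ext (gate_face P j k). c e *\<^sub>R e) = ys ! r"
    by (auto simp: mem_polytope_iff_Ext)
  then show ?thesis using True uniq by (intro exI[of _ c]) auto
next
  case False
  then have "\<not> (r < length ys \<and> vs ! r = j \<and> vs ! Suc r = k)" for r
    using routesD(1)[OF route] by (auto simp: on_def)
  with False show ?thesis by (intro exI[of _ "\<lambda>_. 0"]) auto
qed

text \<open>The routes are arbitrary: almost optimal ones give the comparison of values, optimal
  ones the encoding of optimal solutions.\<close>

lemma f1_encoding_of_routes: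
  assumes sub: "polytopal_subdivision m P"
    and t: "t \<in> {1..m}" and x: "x \<in> P t"
    and s: "\<And>l. l \<in> {1..n} \<Longrightarrow> s l \<in> {1..m}"
    and routes: "\<And>l. l \<in> {1..n} \<Longrightarrow> (vs l, ys l) \<in> routes m P (s l) t"
  obtains S where "f1_feasible m P p n a s S" "f1_encodes m P n t x vs ys S"
    "f1_obj m \<omega> n w S = (\<Sum>l\<in>{1..n}. w l * route_cost p \<omega> (a l) x (vs l) (ys l))"
proof -
  define on where "on l j k \<longleftrightarrow> (\<exists>r. Suc r < length (vs l) \<and> vs l ! r = j \<and> vs l ! Suc r = k)" for l j k
  obtain mu where mu: "\<forall>e\<in>Ext (P t). 0 \<le> mu e" "(\<Sum>e\<in>Ext (P t). mu e) = 1"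
    "(\<Sum>e\<in>Ext (P t). mu e *\<^sub>R e) = x"
    using x polytope_cells[OF sub t] by (auto simp: mem_polytope_iff_Ext)
  define Q where "Q l j k c \<longleftrightarrow> (\<forall>e\<in>Ext (gate_face P j k). 0 \<le> c e) \<and>
    (\<Sum>e\<in>Ext (gate_face P j k). c e) = (if on l j k then 1 else 0::real) \<and>
    (\<not> on l j k \<longrightarrow> (\<Sum>e\<in>Ext (gate_face P j k). c e *\<^sub>R e) = 0) \<and>
    (\<forall>r<length (ys l). vs l ! r = j \<longrightarrow> vs l ! Suc r = k \<longrightarrow>
       (\<Sum>e\<in>Ext (gate_face P j k). c e *\<^sub>R e) = ys l ! r)" for l j k c
  have "\<exists>c. Q l j k c" if "l \<in> {1..n}" for l j k
    unfolding Q_def on_def by (rule gate_coefficients[OF sub routes[OF that]])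
  then obtain lam where "\<And>l j k. l \<in> {1..n} \<Longrightarrow> Q l j k (lam l j k)"
    by metis
  then have lam: "\<And>l j k e. l \<in> {1..n} \<Longrightarrow> e \<in> Ext (gate_face P j k) \<Longrightarrow> 0 \<le> lam l j k e"
    "\<And>l j k. l \<in> {1..n} \<Longrightarrow> (\<Sum>e\<in>Ext (gate_face P j k). lam l j k e) = (if on l j k then 1 else 0)"
    "\<And>l j k. l \<in> {1..n} \<Longrightarrow> \<not> on l j k \<Longrightarrow> (\<Sum>e\<in>Ext (gate_face P j k). lam l j k e *\<^sub>R e) = 0"
    "\<And>l r. l \<in> {1..n} \<Longrightarrow> r < length (ys l) \<Longrightarrow>
       (\<Sum>e\<in>Ext (gate_face P (vs l ! r) (vs l ! Suc r)). lam l (vs l ! r) (vs l ! Suc r) e *\<^sub>R e) = ys l ! r"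
    unfolding Q_def by blast+
  \<comment> \<open>\<open>d\<close> is to equal the norm of a residual, which is a function of the
    whole record but does not depend on its \<open>d\<close> component. So a dummy
    \<open>d = 0\<close> comes first and is then overwritten.\<close>
  define S0 where "S0 = \<lparr>uvar = (\<lambda>i. if i = t then 1 else 0),
    muvar = (\<lambda>i e. if i = t then mu e else 0),
    zvar = (\<lambda>l j k. if on l j k then 1 else 0), lamvar = lam, dvar = (\<lambda>_ _. 0)\<rparr>"
  define S where "S = S0\<lparr>dvar := (\<lambda>l i. lp_norm (p i) (f1_residual m P a s S0 l i))\<rparr>"
  have d: "dvar S l i = lp_norm (p i) (f1_residual m P a s S l i)" for l i
    by (simp add: S_def)
  have z: "zvar S l j k = (if on l j k then 1 else 0)" and u: "uvar S i = (if i = t then 1 else 0)"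
    and la: "lamvar S = lam" and muv: "muvar S i e = (if i = t then mu e else 0)" for l j k i e
    by (simp_all add: S_def S0_def)
  have loc: "f1_location P S i = (if i = t then x else 0)" for i
    by (simp add: f1_location_def muv mu(3))
  have gate_off: "f1_gate P S l j k = 0" if "l \<in> {1..n}" "\<not> on l j k" for l j k
    using lam(3)[OF that] by (simp add: f1_gate_def la)
  have gate_on: "f1_gate P S l (vs l ! r) (vs l ! Suc r) = ys l ! r"
    if "l \<in> {1..n}" "r < length (ys l)" for l r
    using lam(4)[OF that] by (simp add: f1_gate_def la)
  have cost: "(\<Sum>i\<in>{1..m}. \<omega> i * dvar S l i) = route_cost p \<omega> (a l) x (vs l) (ys l)"
    and flow: "(\<Sum>j | (s l, j) \<in> arcs m P. zvar S l (s l) j) -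
        (\<Sum>h | (h, s l) \<in> arcs m P. zvar S l h (s l)) = 1 - uvar S (s l)"
      "\<forall>i\<in>{1..m} - {s l}. (\<Sum>j | (i, j) \<in> arcs m P. zvar S l i j) -
        (\<Sum>h | (h, i) \<in> arcs m P. zvar S l h i) = - uvar S i"
      "\<forall>i\<in>{1..m}. (\<Sum>h | (h, i) \<in> arcs m P. zvar S l h i) \<le> 1 - uvar S (s l)"
      "\<forall>i\<in>{1..m}. (\<Sum>j | (i, j) \<in> arcs m P. zvar S l i j) \<le> 1 - uvar S (s l)"
    if l: "l \<in> {1..n}" for l
  proof -
    note route = routes[OF l]
    note R = routesD[OF route]
    have g_off: "f1_gate P S l j k = 0" if "\<not> (\<exists>r. Suc r < length (vs l) \<and> vs l ! r = j \<and> vs l ! Suc r = k)" for j k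
      using gate_off[OF l] that by (simp add: on_def)
    note gs = path_sums[OF route, where F = "f1_gate P S l", OF g_off]
    have z_off: "zvar S l j k = 0" if "\<not> (\<exists>r. Suc r < length (vs l) \<and> vs l ! r = j \<and> vs l ! Suc r = k)" for j k
      using that by (simp add: z on_def)
    note zs = path_sums[OF route, where F = "zvar S l", OF z_off]
    have z_on: "zvar S l (vs l ! r) (vs l ! Suc r) = 1" if "r < length (ys l)" for r
      using that R(1) by (auto simp: z on_def)
    have cost': "route_cost p \<omega> (a l) x (vs l) (ys l) = (\<Sum>i\<in>set (vs l). \<omega> i * dvar S l i)"
      unfolding d using gs gate_on[OF l]
      by (intro route_cost_eq_residuals[where s = s and l = l and a = a, OF route loc]) auto
    \<comment> \<open>Off the route the location and both gate sums vanish, so the residual is the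
      zero vector.\<close>
    have "dvar S l i = 0" if "i \<notin> set (vs l)" for i
    proof -
      have "i \<noteq> s l" "i \<noteq> t" using that R(1-3) nth_mem[of 0 "vs l"] nth_mem[of "length (ys l)" "vs l"] by auto
      then show ?thesis using gs(3,4)[of i] that by (simp add: d f1_residual_def loc)
    qed
    then show "(\<Sum>i\<in>{1..m}. \<omega> i * dvar S l i) = route_cost p \<omega> (a l) x (vs l) (ys l)"
      unfolding cost' using R(5) by (intro sum.mono_neutral_right) auto
    have st: "s l = t \<longleftrightarrow> ys l = []"
      using nth_eq_iff_index_eq[OF R(4), of 0 "length (ys l)"] R(1-3) by auto
    \<comment> \<open>Out-degrees and in-degrees become indicator functions of the visited cells
      without \<open>t\<close> and without \<open>s l\<close>; the four flow constraints compare
      these indicators.\<close>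
    have outz: "(\<Sum>j | (k, j) \<in> arcs m P. zvar S l k j) = (if k \<in> set (vs l) \<and> k \<noteq> t then 1 else 0)" for k
    proof (cases "k \<in> set (vs l) \<and> k \<noteq> t")
      case True
      then obtain r where "r < length (vs l)" "vs l ! r = k" by (auto simp: in_set_conv_nth)
      moreover from this have "r < length (ys l)" using True R(1,3) by (cases "r = length (ys l)") auto
      ultimately show ?thesis using zs(1)[of r] z_on[of r] True by simp
    qed (use zs(3)[of k] in auto)
    have inz: "(\<Sum>j | (j, k) \<in> arcs m P. zvar S l j k) = (if k \<in> set (vs l) \<and> k \<noteq> s l then 1 else 0)" for k
    proof (cases "k \<in> set (vs l) \<and> k \<noteq> s l")
      case True
      then obtain r where "r < length (vs l)" "vs l ! r = k" by (auto simp: in_set_conv_nth)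
      moreover from this obtain q where "r = Suc q" using True R(2) by (cases r) auto
      ultimately show ?thesis using zs(2)[of q] z_on[of q] True R(1) by simp
    qed (use zs(4)[of k] in auto)
    have ends: "s l \<in> set (vs l)" "t \<in> set (vs l)"
      using R(1-3) nth_mem[of 0 "vs l"] nth_mem[of "length (ys l)" "vs l"] by auto
    \<comment> \<open>When \<open>s l = t\<close>, the degree bounds are 0, so the route must have
      no arcs at all.\<close>
    have single: "set (vs l) = {t}" if "s l = t"
      using routes_selfD[of "vs l" "ys l" m P t] route that by simp
    show "(\<Sum>j | (s l, j) \<in> arcs m P. zvar S l (s l) j) -
        (\<Sum>h | (h, s l) \<in> arcs m P. zvar S l h (s l)) = 1 - uvar S (s l)"
      "\<forall>i\<in>{1..m} - {s l}. (\<Sum>j | (i, j) \<in> arcs m P. zvar S l i j) -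
        (\<Sum>h | (h, i) \<in> arcs m P. zvar S l h i) = - uvar S i"
      "\<forall>i\<in>{1..m}. (\<Sum>h | (h, i) \<in> arcs m P. zvar S l h i) \<le> 1 - uvar S (s l)"
      "\<forall>i\<in>{1..m}. (\<Sum>j | (i, j) \<in> arcs m P. zvar S l i j) \<le> 1 - uvar S (s l)"
      unfolding outz inz u using ends single by auto
  qed
  have "f1_feasible m P p n a s S"
    unfolding f1_feasible_def
  proof (intro conjI)
    show "\<forall>l\<in>{1..n}. lp_norm (p (s l))
          (f1_location P S (s l) + (\<Sum>j | (s l, j) \<in> arcs m P. f1_gate P S l (s l) j) - a l) \<le> dvar S l (s l)"
      "\<forall>l\<in>{1..n}. \<forall>i\<in>{1..m} - {s l}. lp_norm (p i)
          (f1_location P S i + (\<Sum>j | (i, j) \<in> arcs m P. f1_gate P S l i j)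
             - (\<Sum>h | (h, i) \<in> arcs m P. f1_gate P S l h i)) \<le> dvar S l i"
      by (auto simp: d f1_residual_def)
  qed (use t flow lam(1,2) mu in \<open>auto simp: u z la muv d lp_norm_nonneg simp del: One_nat_def\<close>)
  moreover have "f1_encodes m P n t x vs ys S"
    unfolding f1_encodes_def using gate_on by (auto simp: u loc z on_def)
  moreover have "f1_obj m \<omega> n w S = (\<Sum>l\<in>{1..n}. w l * route_cost p \<omega> (a l) x (vs l) (ys l))"
    unfolding f1_obj_def
    by (intro sum.cong refl) (simp add: cost[symmetric] sum_distrib_left mult.assoc)
  ultimately show thesis using that by blast
qed

section \<open>Comparison of the objective values\<close>

lemma locp_obj_le_routes:
  assumes "\<And>l. l \<in> {1..n} \<Longrightarrow> 0 < w l"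
    and "\<And>l. l \<in> {1..n} \<Longrightarrow> path_dist m P p \<omega> (s l) t (a l) x \<le> ereal (c l)"
  shows "locp_obj m P p \<omega> n a s w t x \<le> ereal (\<Sum>l\<in>{1..n}. w l * c l)"
proof -
  have "locp_obj m P p \<omega> n a s w t x \<le> (\<Sum>l\<in>{1..n}. ereal (w l) * ereal (c l))"
    unfolding locp_obj_def using assms
    by (intro sum_mono ereal_mult_left_mono) (auto intro: less_imp_le)
  then show ?thesis by simp
qed

lemma locp_obj_le_f1_obj:
  assumes sub: "polytopal_subdivision m P"
    and pos: "\<And>i. i \<in> {1..m} \<Longrightarrow> 0 < \<omega> i"
    and w: "\<And>l. l \<in> {1..n} \<Longrightarrow> 0 < w l"
    and s: "\<And>l. l \<in> {1..n} \<Longrightarrow> s l \<in> {1..m}"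
    and feas: "f1_feasible m P p n a s S"
    and t: "t \<in> {1..m}" "uvar S t = 1"
  shows "locp_obj m P p \<omega> n a s w t (f1_location P S t) \<le> ereal (f1_obj m \<omega> n w S)"
proof -
  have "path_dist m P p \<omega> (s l) t (a l) (f1_location P S t) \<le> ereal (\<Sum>i\<in>{1..m}. \<omega> i * dvar S l i)"
    if l: "l \<in> {1..n}" for l
  proof -
    obtain vs ys where "(vs, ys) \<in> routes m P (s l) t"
      "route_cost p \<omega> (a l) (f1_location P S t) vs ys \<le> (\<Sum>i\<in>{1..m}. \<omega> i * dvar S l i)"
      using route_from_f1_feasible[where s = s and l = l and \<omega> = \<omega>, OF sub pos s[OF l] l feas t] by blast
    then show ?thesis
      using path_dist_le_route_cost by (meson ereal_less_eq(3) order_trans)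
  qed
  from locp_obj_le_routes[OF w this] show ?thesis
    by (simp add: f1_obj_def sum_distrib_left mult.assoc)
qed

text \<open>Routes within \<epsilon> of each path distance are encoded together, which costs at most
  \<epsilon> times the total weight \<open>W\<close> beyond the objective; then \<epsilon> tends to
  0. An infinite objective makes the claim trivial.\<close>

lemma f1_value_le_locp_obj:
  assumes sub: "polytopal_subdivision m P"
    and pos: "\<And>i. i \<in> {1..m} \<Longrightarrow> 0 < \<omega> i"
    and w: "\<And>l. l \<in> {1..n} \<Longrightarrow> 0 < w l"
    and s: "\<And>l. l \<in> {1..n} \<Longrightarrow> s l \<in> {1..m}"
    and t: "t \<in> {1..m}" and x: "x \<in> P t"
  shows "f1_value m P p \<omega> n a s w \<le> locp_obj m P p \<omega> n a s w t x"
proof (cases "locp_obj m P p \<omega> n a s w t x = \<infinity>")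
  case False
  define D where "D l = path_dist m P p \<omega> (s l) t (a l) x" for l
  have D0: "0 \<le> D l" if "l \<in> {1..n}" for l
    unfolding D_def using path_dist_nonneg[OF s[OF that] pos] .
  have "D l < \<infinity>" if l: "l \<in> {1..n}" for l
  proof (rule ccontr)
    assume "\<not> D l < \<infinity>"
    \<comment> \<open>A positive weight keeps an infinite distance infinite, and nothing in the sum
      can cancel it.\<close>
    then have "ereal (w l) * D l = \<infinity>" using w[OF l] by simp
    then have "(\<Sum>l\<in>{1..n}. ereal (w l) * D l) = \<infinity>"
      using l by (auto simp: sum_Pinfty)
    then show False using False by (simp add: locp_obj_def D_def)
  qed
  then have fin: "ereal (real_of_ereal (D l)) = D l" if "l \<in> {1..n}" for l
    using D0[OF that] that by (auto simp: ereal_real)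
  define W where "W = (\<Sum>l\<in>{1..n}. w l)"
  have "0 \<le> W" unfolding W_def using w by (intro sum_nonneg) (auto intro: less_imp_le)
  have obj: "locp_obj m P p \<omega> n a s w t x = ereal (\<Sum>l\<in>{1..n}. w l * real_of_ereal (D l))"
    unfolding locp_obj_def D_def[symmetric] sum_ereal[symmetric]
    by (intro sum.cong refl) (simp add: fin flip: times_ereal.simps(1))
  have approx: "f1_value m P p \<omega> n a s w \<le> locp_obj m P p \<omega> n a s w t x + ereal (\<epsilon> * W)" if "0 < \<epsilon>" for \<epsilon>
  proof -
    have "\<exists>vy. vy \<in> routes m P (s l) t \<and>
        ereal (route_cost p \<omega> (a l) x (fst vy) (snd vy)) \<le> D l + ereal \<epsilon>" if l: "l \<in> {1..n}" for l
      using path_dist_approx[OF s[OF l] \<open>\<And>l. l \<in> {1..n} \<Longrightarrow> D l < \<infinity>\<close>[OF l, unfolded D_def] \<open>0 < \<epsilon>\<close> pos]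
      unfolding D_def by (metis fst_conv snd_conv)
    then obtain vy where vy: "\<And>l. l \<in> {1..n} \<Longrightarrow> vy l \<in> routes m P (s l) t"
        "\<And>l. l \<in> {1..n} \<Longrightarrow> ereal (route_cost p \<omega> (a l) x (fst (vy l)) (snd (vy l))) \<le> D l + ereal \<epsilon>"
      by metis
    have le: "route_cost p \<omega> (a l) x (fst (vy l)) (snd (vy l)) \<le> real_of_ereal (D l) + \<epsilon>"
      if "l \<in> {1..n}" for l
      using vy(2)[OF that] fin[OF that] by (metis ereal_less_eq(3) plus_ereal.simps(1))
    have pairs: "(fst (vy l), snd (vy l)) \<in> routes m P (s l) t" if "l \<in> {1..n}" for l
      using vy(1)[OF that] by simp
    obtain S where S: "f1_feasible m P p n a s S"
      "f1_obj m \<omega> n w S = (\<Sum>l\<in>{1..n}. w l * route_cost p \<omega> (a l) x (fst (vy l)) (snd (vy l)))"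
      using f1_encoding_of_routes[where n = n and s = s and vs = "\<lambda>l. fst (vy l)" and ys = "\<lambda>l. snd (vy l)"
          and p = p and a = a and \<omega> = \<omega> and w = w, OF sub t x s pairs] by blast
    have "f1_value m P p \<omega> n a s w \<le> ereal (f1_obj m \<omega> n w S)"
      unfolding f1_value_def using S(1) by (intro INF_lower) simp
    also have "f1_obj m \<omega> n w S \<le> (\<Sum>l\<in>{1..n}. w l * (real_of_ereal (D l) + \<epsilon>))"
      unfolding S(2) using le w by (intro sum_mono mult_left_mono) (auto intro: less_imp_le)
    also have "\<dots> = (\<Sum>l\<in>{1..n}. w l * real_of_ereal (D l)) + \<epsilon> * W"
      by (simp add: W_def sum.distrib distrib_left sum_distrib_left mult.commute)
    finally show ?thesis by (simp add: obj)
  qed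
  show ?thesis
  proof (rule ereal_le_epsilon2)
    fix \<delta> :: real assume "0 < \<delta>"
    \<comment> \<open>Dividing by \<open>W + 1\<close> rather than \<open>W\<close> covers the case
      without demand points, where \<open>W = 0\<close>.\<close>
    have "f1_value m P p \<omega> n a s w \<le> locp_obj m P p \<omega> n a s w t x + ereal (\<delta> / (W + 1) * W)"
      using approx[of "\<delta> / (W + 1)"] \<open>0 < \<delta>\<close> \<open>0 \<le> W\<close> by simp
    also have "\<dots> \<le> locp_obj m P p \<omega> n a s w t x + ereal \<delta>"
      using \<open>0 < \<delta>\<close> \<open>0 \<le> W\<close> by (intro add_left_mono) (simp add: field_simps)
    finally show "f1_value m P p \<omega> n a s w \<le> locp_obj m P p \<omega> n a s w t x + ereal \<delta>" .
  qed
qed simp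

lemma locp_value_eq_f1_value:
  assumes sub: "polytopal_subdivision m P"
    and pos: "\<And>i. i \<in> {1..m} \<Longrightarrow> 0 < \<omega> i"
    and w: "\<And>l. l \<in> {1..n} \<Longrightarrow> 0 < w l"
    and s: "\<And>l. l \<in> {1..n} \<Longrightarrow> s l \<in> {1..m}"
  shows "locp_value m P p \<omega> n a s w = f1_value m P p \<omega> n a s w"
proof (rule antisym)
  show "f1_value m P p \<omega> n a s w \<le> locp_value m P p \<omega> n a s w"
    unfolding locp_value_def using f1_value_le_locp_obj[OF sub pos w s] by (intro INF_greatest) auto
  show "locp_value m P p \<omega> n a s w \<le> f1_value m P p \<omega> n a s w"
    unfolding f1_value_def
  proof (rule INF_greatest)
    fix S assume "S \<in> {S. f1_feasible m P p n a s S}"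
    then have feas: "f1_feasible m P p n a s S" by simp
    \<comment> \<open>Every feasible point yields a location that is no worse. Without feasible
      points the infimum is \<infinity> and nothing has to be shown.\<close>
    obtain t where t: "t \<in> {1..m}" "uvar S t = 1"
      using f1_feasible_unique_cell[OF feas] by blast
    have "locp_value m P p \<omega> n a s w \<le> locp_obj m P p \<omega> n a s w t (f1_location P S t)"
      unfolding locp_value_def
      by (intro INF_lower2[OF t(1)] INF_lower f1_feasible_location(1)[OF sub feas t])
    also have "\<dots> \<le> ereal (f1_obj m \<omega> n w S)"
      by (rule locp_obj_le_f1_obj[OF sub pos w s feas t])
    finally show "locp_value m P p \<omega> n a s w \<le> ereal (f1_obj m \<omega> n w S)" .
  qed
qed

section \<open>Transfer of optimal solutions in both directions\<close>

theorem theorem16: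
  fixes m n :: nat
    and P :: "nat \<Rightarrow> (real^'d) set"
    and p :: "nat \<Rightarrow> ereal"
    and \<omega> w :: "nat \<Rightarrow> real"
    and a :: "nat \<Rightarrow> real^'d"
    and s :: "nat \<Rightarrow> nat"
  assumes "polytopal_subdivision m P"
    and "\<And>i. i \<in> {1..m} \<Longrightarrow> 1 \<le> p i"
    and "\<And>i. i \<in> {1..m} \<Longrightarrow> 0 < \<omega> i"
    and "\<And>l. l \<in> {1..n} \<Longrightarrow> 0 < w l"
    and "\<And>l. l \<in> {1..n} \<Longrightarrow> s l \<in> {1..m}"
    and "\<And>l. l \<in> {1..n} \<Longrightarrow> a l \<in> P (s l)"
  shows "locp_value m P p \<omega> n a s w = f1_value m P p \<omega> n a s w \<and>
    (\<forall>t x vs ys.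
       locp_optimal m P p \<omega> n a s w t x \<and> locp_optimal_routes m P p \<omega> n a s t x vs ys \<longrightarrow>
       (\<exists>S. f1_optimal m P p \<omega> n a s w S \<and> f1_encodes m P n t x vs ys S)) \<and>
    (\<forall>S. f1_optimal m P p \<omega> n a s w S \<longrightarrow>
       (\<exists>!t. t \<in> {1..m} \<and> uvar S t = 1) \<and>
       (\<forall>t\<in>{1..m}. uvar S t = 1 \<longrightarrow> locp_optimal m P p \<omega> n a s w t (f1_location P S t)))"
proof (intro conjI allI impI ballI)
  note base = assms(1,3,4,5)
  note eq = locp_value_eq_f1_value[OF base]
  show "locp_value m P p \<omega> n a s w = f1_value m P p \<omega> n a s w" by (rule eq)
  show "\<exists>S. f1_optimal m P p \<omega> n a s w S \<and> f1_encodes m P n t x vs ys S"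
    if "locp_optimal m P p \<omega> n a s w t x \<and> locp_optimal_routes m P p \<omega> n a s t x vs ys" for t x vs ys
  proof -
    from that have t: "t \<in> {1..m}" "x \<in> P t"
      and val: "locp_obj m P p \<omega> n a s w t x = locp_value m P p \<omega> n a s w"
      by (auto simp: locp_optimal_def)
    from that have route: "(vs l, ys l) \<in> routes m P (s l) t"
      and dist: "path_dist m P p \<omega> (s l) t (a l) x = ereal (route_cost p \<omega> (a l) x (vs l) (ys l))"
      if "l \<in> {1..n}" for l
      using that by (auto simp: locp_optimal_routes_def)
    obtain S where S: "f1_feasible m P p n a s S" "f1_encodes m P n t x vs ys S"
      "f1_obj m \<omega> n w S = (\<Sum>l\<in>{1..n}. w l * route_cost p \<omega> (a l) x (vs l) (ys l))"
      using f1_encoding_of_routes[where n = n and s = s and vs = vs and ys = ys, OF assms(1) t assms(5) route] by blast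
    \<comment> \<open>The given routes attain the path distances, so the encoded cost is exactly the
      objective value of (LocP), which is optimal by the equality of values.\<close>
    have "ereal (f1_obj m \<omega> n w S) = locp_obj m P p \<omega> n a s w t x"
      unfolding S(3) locp_obj_def sum_ereal[symmetric]
      by (intro sum.cong refl) (simp add: dist)
    then show ?thesis using S eq val by (auto simp: f1_optimal_def)
  qed
  show "\<exists>!t. t \<in> {1..m} \<and> uvar S t = 1" if "f1_optimal m P p \<omega> n a s w S" for S
    using that f1_feasible_unique_cell unfolding f1_optimal_def by blast
  show "locp_optimal m P p \<omega> n a s w t (f1_location P S t)"
    if "f1_optimal m P p \<omega> n a s w S" "t \<in> {1..m}" "uvar S t = 1" for S t
  proof -
    have feas: "f1_feasible m P p n a s S"
      and val: "ereal (f1_obj m \<omega> n w S) = locp_value m P p \<omega> n a s w"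
      using that(1) eq by (auto simp: f1_optimal_def)
    have loc: "f1_location P S t \<in> P t"
      by (rule f1_feasible_location(1)[OF assms(1) feas that(2,3)])
    \<comment> \<open>The objective at the encoded location is squeezed between the value of (LocP)
      and the optimal cost of \<open>S\<close>, which coincide. Since that cost is a real number,
      the location is also feasible.\<close>
    have le: "locp_obj m P p \<omega> n a s w t (f1_location P S t) \<le> ereal (f1_obj m \<omega> n w S)"
      by (rule locp_obj_le_f1_obj[OF base feas that(2,3)])
    moreover have "locp_value m P p \<omega> n a s w \<le> locp_obj m P p \<omega> n a s w t (f1_location P S t)"
      unfolding locp_value_def by (intro INF_lower2[OF that(2)] INF_lower loc)
    moreover have "locp_obj m P p \<omega> n a s w t (f1_location P S t) < \<infinity>"
      using le by (rule order_le_less_trans) simp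
    ultimately show ?thesis
      using that(2) loc val by (auto simp: locp_optimal_def)
  qed
qed

end
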